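(* Let $n$ be a positive integer and let $M$ and $N$ be fb-tableaux of size $n$. The join $L=M\vee N$ in $\operatorname{esTam}_n$ is the unique tableau defined by: (a) the root of $L$ is a dot; (b) in each row $2,\dots,n$, the left-arrow of $L$ is at the position of the rightmost of the left-arrows of $M$ and $N$ in that row; (c) in each of the columns $1,\dots,n-1$, the up-arrow of $L$ is at the position of the highest of the up-arrows of $M$ and $N$ in that column, except that if this position is pointed by a left-arrow of $L$, it is moved upward to the first position that is not pointed by a left-arrow of $L$; (d) a free cell $c$ of $L$ (a cell strictly below the up-arrow of $L$ in its column and strictly to the right of the left-arrow of $L$ in its row) contains a dot in $L$ if and only if $c$ contains a dot in $M$ or in $N$; all other cells of $L$ are empty.
   Context: Let $n$ be a positive integer. The board of size $n$ is the Ferrers diagram of shape $(n,n,n-1,n-2,\dots,3,2)$ (a single cell $(1,1)$ if $n=1$). Its cells are written $(i,j)$, where $i$ is the row, numbered from the top, and $j$ is the column label, the columns being labelled $n,n-1,\dots,1$ from left to right. So the cells are $(1,j)$ for $1\le j\le n$ and $(i,j)$ for $2\le i\le n$, $i-1\le j\le n$. The root is $(1,n)$ (top-left cell); the border cells are $(i,i-1)$ for $2\le i\le n$ (the rightmost cells of rows $2,\dots,n$). An fb-tableau of size $n$ is a filling in which each cell is either empty or nonempty such that the root and all border cells are nonempty, and every nonempty cell other than the root has a nonempty cell strictly to its left in the same row or strictly above it in the same column. In an fb-tableau, a nonempty cell different from the root is called a left-arrow if there is no nonempty cell strictly to its left in its row, an up-arrow if there is no nonempty cell strictly above it in its column, and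 a dot otherwise; the root is also a dot. (Arrows are not dots. Each of rows $2,\dots,n$ has exactly one left-arrow, each of columns $1,\dots,n-1$ has exactly one up-arrow.) A cell is free in $T$ if it lies strictly below an up-arrow (same column) and strictly to the right of a left-arrow (same row); a free cell is either empty or contains a dot. $\operatorname{Row}(T)$ is the set of cells lying weakly to the right of a left-arrow or of the root in the same row; $\operatorname{Col}(T)$ is the set of cells lying weakly below an up-arrow or the root in the same column. For fb-tableaux $S,T$ of size $n$, write $S\lhd T$ if (1) $\operatorname{Col}(S)\subseteq\operatorname{Col}(T)$; (2) $\operatorname{Row}(T)\subseteq\operatorname{Row}(S)$; (3) for every cell $c$ that is free in both $S$ and $T$, if $c$ contains a dot in $S$ then $c$ contains a dot in $T$. The extra slow Tamari lattice $\operatorname{esTam}_n$ is the set of fb-tableaux of size $n$ ordered by $\lhd$. A cell is pointed by a left-arrow if it lies strictly to the left of the left-arrow of its row. *)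

theory Defs
  imports "HOL-Algebra.Lattice"
begin

text \<open>
  A cell is a pair \<open>(i, j)\<close> of a row \<open>i\<close>, numbered from the top, and a column label \<open>j\<close>. The columns
  are labelled \<open>n, \<dots>, 1\<close> from left to right, so ``strictly to the left'' means a strictly larger
  \<open>j\<close> and ``strictly above'' means a strictly smaller \<open>i\<close>.
\<close>

type_synonym cell = "nat \<times> nat"

text \<open>A filling is represented by the set of its nonempty cells.\<close>

type_synonym filling = "cell set"

definition board :: "nat \<Rightarrow> cell set" where
  "board n = {(i, j). i = 1 \<and> 1 \<le> j \<and> j \<le> n \<or> 2 \<le> i \<and> i \<le> n \<and> i - 1 \<le> j \<and> j \<le> n}"

definition root_cell :: "nat \<Rightarrow> cell" where
  "root_cell n = (1, n)"

definition border_cells :: "nat \<Rightarrow> cell set" where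
  "border_cells n = {(i, i - 1) | i. 2 \<le> i \<and> i \<le> n}"

definition nonempty_left :: "filling \<Rightarrow> cell \<Rightarrow> bool" where
  "nonempty_left T c \<longleftrightarrow> (\<exists>k. snd c < k \<and> (fst c, k) \<in> T)"

definition nonempty_above :: "filling \<Rightarrow> cell \<Rightarrow> bool" where
  "nonempty_above T c \<longleftrightarrow> (\<exists>k. k < fst c \<and> (k, snd c) \<in> T)"

definition fb_tableau :: "nat \<Rightarrow> filling \<Rightarrow> bool" where
  "fb_tableau n T \<longleftrightarrow>
     T \<subseteq> board n \<and> root_cell n \<in> T \<and> border_cells n \<subseteq> T \<and>
     (\<forall>c\<in>T. c \<noteq> root_cell n \<longrightarrow> nonempty_left T c \<or> nonempty_above T c)"

definition left_arrows :: "nat \<Rightarrow> filling \<Rightarrow> cell set" where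
  "left_arrows n T = {c \<in> T. c \<noteq> root_cell n \<and> \<not> nonempty_left T c}"

definition up_arrows :: "nat \<Rightarrow> filling \<Rightarrow> cell set" where
  "up_arrows n T = {c \<in> T. c \<noteq> root_cell n \<and> \<not> nonempty_above T c}"

definition dots :: "nat \<Rightarrow> filling \<Rightarrow> cell set" where
  "dots n T = T - left_arrows n T - up_arrows n T"

definition free_cells :: "nat \<Rightarrow> filling \<Rightarrow> cell set" where
  "free_cells n T = {(i, j) \<in> board n.
     (\<exists>k<i. (k, j) \<in> up_arrows n T) \<and> (\<exists>k>j. (i, k) \<in> left_arrows n T)}"

definition Row :: "nat \<Rightarrow> filling \<Rightarrow> cell set" where
  "Row n T = {(i, j) \<in> board n. \<exists>k\<ge>j. (i, k) \<in> left_arrows n T \<or> (i, k) = root_cell n}"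

definition Col :: "nat \<Rightarrow> filling \<Rightarrow> cell set" where
  "Col n T = {(i, j) \<in> board n. \<exists>k\<le>i. (k, j) \<in> up_arrows n T \<or> (k, j) = root_cell n}"

definition pointed :: "nat \<Rightarrow> filling \<Rightarrow> cell set" where
  "pointed n T = {(i, j) \<in> board n. \<exists>k<j. (i, k) \<in> left_arrows n T}"

definition tab_le :: "nat \<Rightarrow> filling \<Rightarrow> filling \<Rightarrow> bool" where
  "tab_le n S T \<longleftrightarrow>
     Col n S \<subseteq> Col n T \<and> Row n T \<subseteq> Row n S \<and>
     (\<forall>c \<in> free_cells n S \<inter> free_cells n T. c \<in> dots n S \<longrightarrow> c \<in> dots n T)"

definition esTam :: "nat \<Rightarrow> filling gorder" where
  "esTam n = \<lparr>carrier = {T. fb_tableau n T}, eq = (=), le = tab_le n\<rparr>"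

definition rightmost_left :: "nat \<Rightarrow> filling \<Rightarrow> filling \<Rightarrow> nat \<Rightarrow> nat" where
  "rightmost_left n M N i = Min {j. (i, j) \<in> left_arrows n M \<union> left_arrows n N}"

definition highest_up :: "nat \<Rightarrow> filling \<Rightarrow> filling \<Rightarrow> nat \<Rightarrow> nat" where
  "highest_up n M N j = Min {i. (i, j) \<in> up_arrows n M \<union> up_arrows n N}"

text \<open>
  Row of the cell obtained from \<open>(h, j)\<close> by moving upward in column \<open>j\<close>, if \<open>(h, j)\<close> is pointed by a
  left-arrow of \<open>L\<close>, to the first (hence lowest) position that is not pointed.
\<close>

definition move_up :: "nat \<Rightarrow> filling \<Rightarrow> nat \<Rightarrow> nat \<Rightarrow> nat" where
  "move_up n L j h =
     (if (h, j) \<in> pointed n L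
      then Max {k. k < h \<and> (k, j) \<in> board n \<and> (k, j) \<notin> pointed n L}
      else h)"

definition join_rules :: "nat \<Rightarrow> filling \<Rightarrow> filling \<Rightarrow> filling \<Rightarrow> bool" where
  "join_rules n M N L \<longleftrightarrow>
     root_cell n \<in> dots n L \<and>
     (\<forall>i\<in>{2..n}. \<forall>j. (i, j) \<in> left_arrows n L \<longleftrightarrow> j = rightmost_left n M N i) \<and>
     (\<forall>j\<in>{1..n - 1}. \<forall>i. (i, j) \<in> up_arrows n L \<longleftrightarrow> i = move_up n L j (highest_up n M N j)) \<and>
     (\<forall>c \<in> free_cells n L. c \<in> dots n L \<longleftrightarrow> c \<in> dots n M \<or> c \<in> dots n N) \<and>
     (\<forall>c \<in> board n. c \<noteq> root_cell n \<and> c \<notin> left_arrows n L \<and> c \<notin> up_arrows n L \<and>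
        c \<notin> free_cells n L \<longrightarrow> c \<notin> L)"

end

theory Submission
  imports Defs
begin

text \<open>
  A tableau is determined by the column of the left-arrow in each row \<open>2, \<dots>, n\<close>, the row of the
  up-arrow in each column \<open>1, \<dots>, n - 1\<close> and its set of free dots; in these terms \<open>S \<lhd> T\<close> means that
  the left-arrows of \<open>T\<close> are weakly to the right, its up-arrows weakly higher, and the dots on
  commonly free cells are kept. An upper bound \<open>K\<close> of \<open>M\<close> and \<open>N\<close> thus has its left-arrows weakly to
  the right of the rightmost ones of \<open>M\<close> and \<open>N\<close>. Its up-arrows are weakly higher than those of \<open>M\<close>
  and \<open>N\<close> and not pointed by left-arrows of \<open>K\<close>, hence not pointed by left-arrows of the join \<open>L\<close>,
  which forces them weakly above the moved position of rule (c). A cell free in \<open>L\<close> carrying a dot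
  of \<open>M\<close> is free in \<open>M\<close>, so that dot is inherited by \<open>K\<close>.
\<close>

section \<open>Arrow positions as coordinates of a tableau\<close>

text \<open>Column labels grow leftwards, so the maximum picks the leftmost nonempty cell of the
  row, which in rows \<open>2\<close> to \<open>n\<close> is the left-arrow.\<close>

definition lcol :: "filling \<Rightarrow> nat \<Rightarrow> nat" where
  "lcol T i = Max {j. (i, j) \<in> T}"

definition urow :: "filling \<Rightarrow> nat \<Rightarrow> nat" where
  "urow T j = Min {i. (i, j) \<in> T}"

lemma mem_board_iff:
  "(i, j) \<in> board n \<longleftrightarrow> 1 \<le> i \<and> i \<le> n \<and> 1 \<le> j \<and> j \<le> n \<and> i \<le> j + 1"
  by (auto simp: board_def)

lemma board_downward_closed:
  assumes "(i, j) \<in> board n" "1 \<le> k" "k \<le> i"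
  shows "(k, j) \<in> board n"
  using assms by (auto simp: mem_board_iff)

context
  fixes n T
  assumes fb: "fb_tableau n T"
begin

lemma fb_board: "(i, j) \<in> T \<Longrightarrow> (i, j) \<in> board n"
  using fb by (auto simp: fb_tableau_def)

lemma fb_root: "(1, n) \<in> T"
  using fb by (auto simp: fb_tableau_def root_cell_def)

lemma fb_border: "2 \<le> i \<Longrightarrow> i \<le> n \<Longrightarrow> (i, i - 1) \<in> T"
  using fb by (auto simp: fb_tableau_def border_cells_def)

lemma finite_row: "finite {j. (i, j) \<in> T}"
  by (rule finite_subset[of _ "{..n}"]) (auto dest: fb_board simp: mem_board_iff)

lemma finite_col: "finite {i. (i, j) \<in> T}"
  by (rule finite_subset[of _ "{..n}"]) (auto dest: fb_board simp: mem_board_iff)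

lemma le_lcol: "(i, j) \<in> T \<Longrightarrow> j \<le> lcol T i"
  unfolding lcol_def using finite_row by (auto intro: Max_ge)

lemma urow_le: "(i, j) \<in> T \<Longrightarrow> urow T j \<le> i"
  unfolding urow_def using finite_col by (auto intro: Min_le)

lemma lcol_mem: "2 \<le> i \<Longrightarrow> i \<le> n \<Longrightarrow> (i, lcol T i) \<in> T"
  unfolding lcol_def using Max_in[OF finite_row, of i] fb_border[of i] by auto

lemma urow_mem: "1 \<le> j \<Longrightarrow> j < n \<Longrightarrow> (urow T j, j) \<in> T"
  unfolding urow_def using Min_in[OF finite_col, of j] fb_border[of "j + 1"] by auto

text \<open>Border cells keep rows \<open>2\<close> to \<open>n\<close> nonempty, so
  \<open>lcol\<close> is attained there; row \<open>1\<close> has no left-arrow because the root is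
  its leftmost cell.\<close>

lemma left_arrows_iff: "(i, j) \<in> left_arrows n T \<longleftrightarrow> 2 \<le> i \<and> i \<le> n \<and> j = lcol T i"
proof
  assume a: "(i, j) \<in> left_arrows n T"
  then have T: "(i, j) \<in> T" and nr: "(i, j) \<noteq> (1, n)" and nl: "\<And>k. (i, k) \<in> T \<Longrightarrow> k \<le> j"
    by (auto simp: left_arrows_def root_cell_def nonempty_left_def not_less[symmetric])
  have "i \<noteq> 1"
    using nl[of n] nr fb_root fb_board[OF T] by (auto simp: mem_board_iff)
  then show "2 \<le> i \<and> i \<le> n \<and> j = lcol T i"
    using fb_board[OF T] nl[OF lcol_mem] le_lcol[OF T] by (force simp: mem_board_iff)
next
  assume "2 \<le> i \<and> i \<le> n \<and> j = lcol T i"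
  then show "(i, j) \<in> left_arrows n T"
    using lcol_mem[of i] le_lcol[of i]
    by (force simp: left_arrows_def root_cell_def nonempty_left_def not_less)
qed

lemma up_arrows_iff: "(i, j) \<in> up_arrows n T \<longleftrightarrow> 1 \<le> j \<and> j < n \<and> i = urow T j"
proof
  assume a: "(i, j) \<in> up_arrows n T"
  then have T: "(i, j) \<in> T" and nr: "(i, j) \<noteq> (1, n)" and na: "\<And>k. (k, j) \<in> T \<Longrightarrow> i \<le> k"
    by (auto simp: up_arrows_def root_cell_def nonempty_above_def not_less[symmetric])
  have "j \<noteq> n"
    using na[of 1] nr fb_root fb_board[OF T] by (auto simp: mem_board_iff)
  then show "1 \<le> j \<and> j < n \<and> i = urow T j"
    using fb_board[OF T] na[OF urow_mem] urow_le[OF T] by (force simp: mem_board_iff)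
next
  assume "1 \<le> j \<and> j < n \<and> i = urow T j"
  then show "(i, j) \<in> up_arrows n T"
    using urow_mem[of j] urow_le[of _ j]
    by (force simp: up_arrows_def root_cell_def nonempty_above_def not_less)
qed

lemma Row_iff: "(i, j) \<in> Row n T \<longleftrightarrow> (i, j) \<in> board n \<and> (2 \<le> i \<longrightarrow> j \<le> lcol T i)"
proof (cases "2 \<le> i")
  case True
  then show ?thesis by (auto simp: Row_def left_arrows_iff root_cell_def mem_board_iff)
next
  case False
  then show ?thesis by (auto simp: Row_def root_cell_def mem_board_iff intro!: exI[of _ n])
qed

lemma Col_iff: "(i, j) \<in> Col n T \<longleftrightarrow> (i, j) \<in> board n \<and> (j < n \<longrightarrow> urow T j \<le> i)"
proof (cases "j < n")
  case True
  then show ?thesis by (auto simp: Col_def up_arrows_iff root_cell_def mem_board_iff)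
next
  case False
  then show ?thesis by (auto simp: Col_def root_cell_def mem_board_iff intro!: exI[of _ 1])
qed

lemma pointed_iff: "(i, j) \<in> pointed n T \<longleftrightarrow> (i, j) \<in> board n \<and> 2 \<le> i \<and> lcol T i < j"
  by (auto simp: pointed_def left_arrows_iff mem_board_iff)

lemma free_iff:
  "(i, j) \<in> free_cells n T \<longleftrightarrow> (i, j) \<in> board n \<and> 2 \<le> i \<and> j < n \<and> urow T j < i \<and> j < lcol T i"
  by (auto simp: free_cells_def left_arrows_iff up_arrows_iff mem_board_iff)

text \<open>The left-or-above condition on nonempty cells enters here: a cell that is both kinds of
  arrow would violate it.\<close>

lemma arrows_disjoint: "c \<in> left_arrows n T \<Longrightarrow> c \<notin> up_arrows n T"
  using fb by (auto simp: fb_tableau_def left_arrows_def up_arrows_def)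

lemma root_dot: "root_cell n \<in> dots n T"
  using fb_root by (auto simp: dots_def left_arrows_def up_arrows_def root_cell_def)

text \<open>A left-arrow outside column \<open>n\<close> cannot coincide with the up-arrow of its
  column, so that up-arrow is strictly higher.\<close>

lemma urow_less_if_lcol:
  assumes "2 \<le> i" "i \<le> n" "lcol T i < n"
  shows "urow T (lcol T i) < i"
proof -
  have T: "(i, lcol T i) \<in> T" using lcol_mem assms by auto
  have "i \<noteq> urow T (lcol T i)"
    using arrows_disjoint[of "(i, lcol T i)"] assms fb_board[OF T]
    by (auto simp: left_arrows_iff up_arrows_iff mem_board_iff)
  then show ?thesis using urow_le[OF T] by auto
qed

text \<open>The mirror image, again from disjointness of arrows; it says that an up-arrow is never
  pointed by a left-arrow.\<close>

lemma less_lcol_if_urow: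
  assumes "1 \<le> j" "j < n" "2 \<le> urow T j"
  shows "j < lcol T (urow T j)"
proof -
  have T: "(urow T j, j) \<in> T" using urow_mem assms by auto
  have "j \<noteq> lcol T (urow T j)"
    using arrows_disjoint[of "(urow T j, j)"] assms fb_board[OF T]
    by (auto simp: left_arrows_iff up_arrows_iff mem_board_iff)
  then show ?thesis using le_lcol[OF T] by auto
qed

text \<open>Both arrows bound a nonempty cell outside row \<open>1\<close> and column
  \<open>n\<close>: a tie with either bound makes it that arrow, two strict bounds make it
  free.\<close>

lemma mem_cases:
  assumes "(i, j) \<in> T"
  shows "(i, j) = (1, n) \<or> (2 \<le> i \<and> i \<le> n \<and> j = lcol T i)
    \<or> (1 \<le> j \<and> j < n \<and> i = urow T j) \<or> (i, j) \<in> free_cells n T"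
proof (cases "2 \<le> i \<and> j < n")
  case True
  then show ?thesis
    using le_lcol[OF assms] urow_le[OF assms] fb_board[OF assms]
    by (auto simp: free_iff mem_board_iff)
next
  case False
  then show ?thesis
    using le_lcol[OF assms] urow_le[OF assms] fb_board[OF assms]
      fb_board[OF lcol_mem, of i] fb_board[OF urow_mem, of j]
    by (auto simp: mem_board_iff)
qed

lemma dots_iff: "c \<in> dots n T \<longleftrightarrow> c \<in> T \<and> (c = (1, n) \<or> c \<in> free_cells n T)"
proof (cases c)
  case (Pair i j)
  have "c \<in> dots n T" if "c \<in> T" "c \<in> free_cells n T"
    using that unfolding dots_def Pair by (auto simp: free_iff left_arrows_iff up_arrows_iff)
  then show ?thesis
    using root_dot mem_cases[of i j] fb_root unfolding Pair
    by (auto simp: dots_def left_arrows_iff up_arrows_iff root_cell_def)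
qed

end

section \<open>The order in coordinates and its antisymmetry\<close>

lemma tab_le_iff:
  assumes S: "fb_tableau n S" and T: "fb_tableau n T"
  shows "tab_le n S T \<longleftrightarrow> (\<forall>j. 1 \<le> j \<and> j < n \<longrightarrow> urow T j \<le> urow S j) \<and>
    (\<forall>i. 2 \<le> i \<and> i \<le> n \<longrightarrow> lcol T i \<le> lcol S i) \<and>
    (\<forall>c \<in> free_cells n S \<inter> free_cells n T. c \<in> S \<longrightarrow> c \<in> T)"
proof -
  have "Col n S \<subseteq> Col n T \<longleftrightarrow> (\<forall>j. 1 \<le> j \<and> j < n \<longrightarrow> urow T j \<le> urow S j)" (is "?l = ?r")
  proof
    assume l: ?l
    show ?r
    proof (intro allI impI)
      fix j assume j: "1 \<le> j \<and> j < n"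
      \<comment> \<open>The up-arrow is the topmost cell of \<open>Col n S\<close> in its column, so
        the inclusion at this one cell already gives the inequality.\<close>
      then have "(urow S j, j) \<in> Col n S"
        using fb_board[OF S urow_mem[OF S, of j]] by (auto simp: Col_iff[OF S])
      then show "urow T j \<le> urow S j" using l j by (auto simp: Col_iff[OF T])
    qed
  next
    assume ?r then show ?l by (fastforce simp: Col_iff[OF T] Col_iff[OF S] mem_board_iff)
  qed
  moreover have "Row n T \<subseteq> Row n S \<longleftrightarrow> (\<forall>i. 2 \<le> i \<and> i \<le> n \<longrightarrow> lcol T i \<le> lcol S i)" (is "?l = ?r")
  proof
    assume l: ?l
    show ?r
    proof (intro allI impI)
      fix i assume i: "2 \<le> i \<and> i \<le> n"
      then have "(i, lcol T i) \<in> Row n T"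
        using fb_board[OF T lcol_mem[OF T, of i]] by (auto simp: Row_iff[OF T])
      then show "lcol T i \<le> lcol S i" using l i by (auto simp: Row_iff[OF S])
    qed
  next
    assume ?r then show ?l by (fastforce simp: Row_iff[OF T] Row_iff[OF S] mem_board_iff)
  qed
  ultimately show ?thesis
    unfolding tab_le_def by (auto simp: dots_iff[OF S] dots_iff[OF T])
qed

text \<open>Comparison in both directions equates the arrows, hence the free cells, and on these the
  third condition transfers all dots.\<close>

lemma tab_le_antisym:
  assumes S: "fb_tableau n S" and T: "fb_tableau n T" and "tab_le n S T" "tab_le n T S"
  shows "S = T"
proof -
  have sub: "A \<subseteq> B" if A: "fb_tableau n A" and B: "fb_tableau n B"
    and "tab_le n A B" "tab_le n B A" for A B
  proof
    fix c assume "c \<in> A"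
    moreover obtain i j where c: "c = (i, j)" by (cases c)
    ultimately have mem: "(i, j) \<in> A" by simp
    have u: "urow A j = urow B j" if "1 \<le> j" "j < n"
      using \<open>tab_le n A B\<close> \<open>tab_le n B A\<close> that
      by (auto simp: tab_le_iff[OF A B] tab_le_iff[OF B A] intro: antisym)
    have l: "lcol A i = lcol B i" if "2 \<le> i" "i \<le> n"
      using \<open>tab_le n A B\<close> \<open>tab_le n B A\<close> that
      by (auto simp: tab_le_iff[OF A B] tab_le_iff[OF B A] intro: antisym)
    have "(i, j) \<in> free_cells n A \<Longrightarrow> (i, j) \<in> free_cells n B"
      using u l by (auto simp: free_iff[OF A] free_iff[OF B] mem_board_iff)
    then show "c \<in> B"
      using mem_cases[OF A mem] u l fb_root[OF B] lcol_mem[OF B, of i] urow_mem[OF B, of j] mem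
        \<open>tab_le n A B\<close> unfolding c
      by (auto simp: tab_le_iff[OF A B])
  qed
  show ?thesis using sub[OF S T] sub[OF T S] assms by auto
qed

section \<open>Building a tableau from prescribed arrows and dots\<close>

text \<open>\<open>D\<close> only proposes dots: it is cut down to the cells that the prescribed
  arrows make free, so any set may be supplied.\<close>

definition tableau_of :: "nat \<Rightarrow> (nat \<Rightarrow> nat) \<Rightarrow> (nat \<Rightarrow> nat) \<Rightarrow> cell set \<Rightarrow> filling" where
  "tableau_of n l u D = {(i, j) \<in> board n. (i, j) = (1, n) \<or> (2 \<le> i \<and> j = l i) \<or> (j < n \<and> i = u j) \<or>
     (2 \<le> i \<and> j < n \<and> u j < i \<and> j < l i \<and> (i, j) \<in> D)}"

text \<open>Realizability: \<open>lu\<close> and \<open>ul\<close> keep the two kinds of arrows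
  compatible, and \<open>border\<close> supplies a dot for each border cell that carries no
  arrow.\<close>

lemma tableau_of:
  fixes l u :: "nat \<Rightarrow> nat"
  assumes n: "n \<ge> 1"
    and l: "\<And>i. 2 \<le> i \<Longrightarrow> i \<le> n \<Longrightarrow> i \<le> l i + 1 \<and> l i \<le> n"
    and u: "\<And>j. 1 \<le> j \<Longrightarrow> j < n \<Longrightarrow> 1 \<le> u j \<and> u j \<le> j + 1"
    and lu: "\<And>i. 2 \<le> i \<Longrightarrow> i \<le> n \<Longrightarrow> l i < n \<Longrightarrow> u (l i) < i"
    and ul: "\<And>j. 1 \<le> j \<Longrightarrow> j < n \<Longrightarrow> 2 \<le> u j \<Longrightarrow> j < l (u j)"
    and border: "\<And>j. 1 \<le> j \<Longrightarrow> j < n \<Longrightarrow> u j \<le> j \<Longrightarrow> j < l (j + 1) \<Longrightarrow> (j + 1, j) \<in> D"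
  defines "T \<equiv> tableau_of n l u D"
  shows "fb_tableau n T"
    and "\<And>i. 2 \<le> i \<Longrightarrow> i \<le> n \<Longrightarrow> lcol T i = l i"
    and "\<And>j. 1 \<le> j \<Longrightarrow> j < n \<Longrightarrow> urow T j = u j"
    and "\<And>c. c \<in> free_cells n T \<Longrightarrow> c \<in> T \<longleftrightarrow> c \<in> D"
proof -
  have board: "(i, j) \<in> board n" if "(i, j) \<in> T" for i j
    using that by (auto simp: T_def tableau_of_def)
  have root: "(1, n) \<in> T" using n by (auto simp: T_def tableau_of_def mem_board_iff)
  have left: "(i, l i) \<in> T" if "2 \<le> i" "i \<le> n" for i
    using l[OF that] that by (auto simp: T_def tableau_of_def mem_board_iff)
  have up: "(u j, j) \<in> T" if "1 \<le> j" "j < n" for j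
    using u[OF that] that by (auto simp: T_def tableau_of_def mem_board_iff)
  \<comment> \<open>Only an up-arrow could lie to the left of the prescribed left-arrow, and
    \<open>ul\<close> excludes this.\<close>
  have le_l: "j \<le> l i" if "(i, j) \<in> T" "2 \<le> i" for i j
    using that ul[of j] by (auto simp: T_def tableau_of_def mem_board_iff)
  have u_le: "u j \<le> i" if "(i, j) \<in> T" "j < n" for i j
    using that lu[of i] by (auto simp: T_def tableau_of_def mem_board_iff)
  have border': "(j + 1, j) \<in> T" if j: "1 \<le> j" "j < n" for j
  proof (cases "u j = j + 1 \<or> l (j + 1) = j")
    case True
    then show ?thesis using left[of "j + 1"] up[of j] j by auto
  next
    case False
    then have "u j \<le> j" "j < l (j + 1)" using u[OF j] l[of "j + 1"] j by auto
    then show ?thesis using border[OF j] j by (auto simp: T_def tableau_of_def mem_board_iff)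
  qed
  show fb: "fb_tableau n T"
    unfolding fb_tableau_def
  proof (intro conjI ballI impI)
    show "T \<subseteq> board n" using board by auto
    show "root_cell n \<in> T" using root by (simp add: root_cell_def)
    show "border_cells n \<subseteq> T"
    proof
      fix c assume "c \<in> border_cells n"
      then obtain i where "c = (i, i - 1)" "2 \<le> i" "i \<le> n" by (auto simp: border_cells_def)
      then show "c \<in> T" using border'[of "i - 1"] by auto
    qed
    fix c assume c: "c \<in> T" "c \<noteq> root_cell n"
    obtain i j where ij: "c = (i, j)" by (cases c)
    have b: "(i, j) \<in> board n" using c ij board by auto
    show "nonempty_left T c \<or> nonempty_above T c"
    \<comment> \<open>A left-arrow has the root or, by \<open>lu\<close>, an up-arrow above it; any
      other non-root cell has the root or a left-arrow to its left.\<close>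
    proof (cases "2 \<le> i \<and> j = l i")
      case True
      have "nonempty_above T c"
      proof (cases "j = n")
        case True
        then show ?thesis using \<open>2 \<le> i \<and> j = l i\<close> root unfolding nonempty_above_def ij by force
      next
        case False
        then have "u j < i" using True lu[of i] b by (auto simp: mem_board_iff)
        then show ?thesis
          using up[of j] False b unfolding nonempty_above_def ij by (force simp: mem_board_iff)
      qed
      then show ?thesis ..
    next
      case False
      have "nonempty_left T c"
      proof (cases "i = 1")
        case True
        then have "j < n" using c ij b by (auto simp: root_cell_def mem_board_iff)
        then show ?thesis using True root unfolding nonempty_left_def ij by auto
      next
        case i: False
        then have "2 \<le> i" "i \<le> n" using b by (auto simp: mem_board_iff)
        moreover have "j < l i" using le_l[of i j] c ij False \<open>2 \<le> i\<close> by auto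
        ultimately show ?thesis using left[of i] unfolding nonempty_left_def ij by auto
      qed
      then show ?thesis ..
    qed
  qed
  show ll: "lcol T i = l i" if "2 \<le> i" "i \<le> n" for i
    using le_lcol[OF fb left[OF that]] le_l[OF lcol_mem[OF fb that]] that by auto
  show uu: "urow T j = u j" if "1 \<le> j" "j < n" for j
    using urow_le[OF fb up[OF that]] u_le[OF urow_mem[OF fb that]] that by auto
  show "c \<in> T \<longleftrightarrow> c \<in> D" if c: "c \<in> free_cells n T" for c
  proof (cases c)
    case (Pair i j)
    then have "(i, j) \<in> board n" "2 \<le> i" "j < n" "u j < i" "j < l i"
      using c ll[of i] uu[of j] by (auto simp: free_iff[OF fb] mem_board_iff)
    then show ?thesis unfolding Pair T_def tableau_of_def by auto
  qed
qed

section \<open>Rules (a)-(d) in coordinates\<close>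

definition jcol :: "filling \<Rightarrow> filling \<Rightarrow> nat \<Rightarrow> nat" where
  "jcol M N i = min (lcol M i) (lcol N i)"

text \<open>
  Since \<open>k\<close> may be the highest up-arrow position itself, the maximum covers both cases of rule (c).
\<close>

definition jrow :: "filling \<Rightarrow> filling \<Rightarrow> nat \<Rightarrow> nat" where
  "jrow M N j = Max {k. 1 \<le> k \<and> k \<le> min (urow M j) (urow N j) \<and> (2 \<le> k \<longrightarrow> j \<le> jcol M N k)}"

context
  fixes n M N
  assumes M: "fb_tableau n M" and N: "fb_tableau n N"
begin

lemma rightmost_left_eq: "2 \<le> i \<Longrightarrow> i \<le> n \<Longrightarrow> rightmost_left n M N i = jcol M N i"
proof -
  assume "2 \<le> i" "i \<le> n"
  then have "{j. (i, j) \<in> left_arrows n M \<union> left_arrows n N} = {lcol M i, lcol N i}"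
    by (auto simp: left_arrows_iff[OF M] left_arrows_iff[OF N])
  then show ?thesis by (simp add: rightmost_left_def jcol_def)
qed

lemma highest_up_eq: "1 \<le> j \<Longrightarrow> j < n \<Longrightarrow> highest_up n M N j = min (urow M j) (urow N j)"
proof -
  assume "1 \<le> j" "j < n"
  then have "{i. (i, j) \<in> up_arrows n M \<union> up_arrows n N} = {urow M j, urow N j}"
    by (auto simp: up_arrows_iff[OF M] up_arrows_iff[OF N])
  then show ?thesis by (simp add: highest_up_def)
qed

lemma highest_up_board:
  assumes "1 \<le> j" "j < n"
  shows "(min (urow M j) (urow N j), j) \<in> board n"
  using fb_board[OF M urow_mem[OF M assms]] fb_board[OF N urow_mem[OF N assms]]
  by (auto simp: min_def)

lemma jrow_props:
  assumes "1 \<le> j" "j < n"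
  shows "1 \<le> jrow M N j" "jrow M N j \<le> min (urow M j) (urow N j)"
    "2 \<le> jrow M N j \<Longrightarrow> j \<le> jcol M N (jrow M N j)"
    "\<And>k. 1 \<le> k \<Longrightarrow> k \<le> min (urow M j) (urow N j) \<Longrightarrow> (2 \<le> k \<Longrightarrow> j \<le> jcol M N k) \<Longrightarrow> k \<le> jrow M N j"
proof -
  let ?A = "{k. 1 \<le> k \<and> k \<le> min (urow M j) (urow N j) \<and> (2 \<le> k \<longrightarrow> j \<le> jcol M N k)}"
  have fin: "finite ?A" by (rule finite_subset[of _ "{..urow M j}"]) auto
  \<comment> \<open>Row \<open>1\<close> has no left-arrow, so moving upward always finds an
    admissible position.\<close>
  have "1 \<in> ?A" using highest_up_board[OF assms] by (auto simp: mem_board_iff)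
  then have "jrow M N j \<in> ?A" unfolding jrow_def using fin by (intro Max_in) auto
  then show "1 \<le> jrow M N j" "jrow M N j \<le> min (urow M j) (urow N j)"
    "2 \<le> jrow M N j \<Longrightarrow> j \<le> jcol M N (jrow M N j)" by auto
  show "k \<le> jrow M N j" if "1 \<le> k" "k \<le> min (urow M j) (urow N j)" "2 \<le> k \<Longrightarrow> j \<le> jcol M N k" for k
    unfolding jrow_def using fin that by (intro Max_ge) auto
qed

text \<open>The moved position depends on \<open>L\<close> only through its left-arrows, so rule (b)
  alone determines it.\<close>

lemma move_up_eq:
  assumes L: "fb_tableau n L" and l: "\<And>i. 2 \<le> i \<Longrightarrow> i \<le> n \<Longrightarrow> lcol L i = jcol M N i"
    and j: "1 \<le> j" "j < n"
  shows "move_up n L j (highest_up n M N j) = jrow M N j"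
proof -
  define h where "h = min (urow M j) (urow N j)"
  have hb: "(h, j) \<in> board n" using highest_up_board[OF j] by (simp add: h_def)
  have p: "(k, j) \<in> pointed n L \<longleftrightarrow> 2 \<le> k \<and> jcol M N k < j" if "1 \<le> k" "k \<le> h" for k
    using board_downward_closed[OF hb that] l[of k] by (auto simp: pointed_iff[OF L] mem_board_iff)
  have h1: "1 \<le> h" using hb by (auto simp: mem_board_iff)
  show ?thesis
  proof (cases "(h, j) \<in> pointed n L")
    case True
    then have h: "2 \<le> h" "jcol M N h < j" using p[of h] h1 by auto
    \<comment> \<open>As \<open>(h, j)\<close> is pointed, \<open>h\<close> itself fails the
      condition on the right, so allowing \<open>k = h\<close> there changes nothing.\<close>
    have "k < h \<and> (k, j) \<in> board n \<and> (k, j) \<notin> pointed n L \<longleftrightarrow>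
        1 \<le> k \<and> k \<le> h \<and> (2 \<le> k \<longrightarrow> j \<le> jcol M N k)" for k
    proof (cases "1 \<le> k \<and> k \<le> h")
      case True
      moreover have "(k, j) \<in> board n" using board_downward_closed[OF hb] True by blast
      ultimately show ?thesis using p[of k] h by (cases "k = h") auto
    next
      case False
      then show ?thesis by (auto simp: mem_board_iff)
    qed
    then show ?thesis using True
      by (simp add: move_up_def highest_up_eq[OF j] jrow_def h_def)
  next
    case False
    then have "h \<le> jrow M N j" using jrow_props(4)[OF j, of h] p[of h] h1 by (auto simp: h_def)
    then have "jrow M N j = h" using jrow_props(2)[OF j] by (simp add: h_def)
    then show ?thesis using False by (simp add: move_up_def highest_up_eq[OF j] h_def)
  qed
qed

text \<open>Rule (a) and the emptiness of the remaining cells hold in every tableau, by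
  \<open>root_dot\<close> and \<open>mem_cases\<close>. Rule (c) is translated under rule (b),
  because pointedness refers to the left-arrows of \<open>L\<close>.\<close>

lemma join_rules_iff:
  assumes L: "fb_tableau n L"
  shows "join_rules n M N L \<longleftrightarrow>
    (\<forall>i. 2 \<le> i \<and> i \<le> n \<longrightarrow> lcol L i = jcol M N i) \<and>
    (\<forall>j. 1 \<le> j \<and> j < n \<longrightarrow> urow L j = jrow M N j) \<and>
    (\<forall>c \<in> free_cells n L. c \<in> L \<longleftrightarrow> c \<in> dots n M \<union> dots n N)"
proof -
  have "(\<forall>i\<in>{2..n}. \<forall>j. (i, j) \<in> left_arrows n L \<longleftrightarrow> j = rightmost_left n M N i) \<longleftrightarrow>
     (\<forall>i. 2 \<le> i \<and> i \<le> n \<longrightarrow> lcol L i = jcol M N i)" (is "?a \<longleftrightarrow> ?a'")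
    by (auto simp: left_arrows_iff[OF L] rightmost_left_eq)
  moreover have "(\<forall>j\<in>{1..n - 1}. \<forall>i. (i, j) \<in> up_arrows n L \<longleftrightarrow> i = move_up n L j (highest_up n M N j))
     \<longleftrightarrow> (\<forall>j. 1 \<le> j \<and> j < n \<longrightarrow> urow L j = jrow M N j)" if ?a'
  proof -
    have "j \<in> {1..n - 1} \<longleftrightarrow> 1 \<le> j \<and> j < n" for j by auto
    moreover have "(\<forall>i. (i, j) \<in> up_arrows n L \<longleftrightarrow> i = move_up n L j (highest_up n M N j))
        \<longleftrightarrow> urow L j = jrow M N j" if "1 \<le> j" "j < n" for j
      using that \<open>?a'\<close> by (auto simp: up_arrows_iff[OF L] move_up_eq[OF L])
    ultimately show ?thesis by blast
  qed
  moreover have "(c \<in> dots n L) = (c \<in> L)" if "c \<in> free_cells n L" for c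
    using that by (auto simp: dots_iff[OF L])
  moreover have "c \<notin> L" if "c \<noteq> root_cell n \<and> c \<notin> left_arrows n L \<and> c \<notin> up_arrows n L \<and>
        c \<notin> free_cells n L" for c
    using that mem_cases[OF L, of "fst c" "snd c"]
    by (cases c) (auto simp: left_arrows_iff[OF L] up_arrows_iff[OF L] root_cell_def)
  ultimately show ?thesis
    unfolding join_rules_def using root_dot[OF L] by (auto 0 3)
qed

section \<open>Existence of the tableau defined by the rules\<close>

lemma ex_join_rules: "\<exists>L. fb_tableau n L \<and> join_rules n M N L"
proof -
  define D where "D = dots n M \<union> dots n N"
  have n: "n \<ge> 1" using fb_board[OF M fb_root[OF M]] by (auto simp: mem_board_iff)
  have l: "i \<le> jcol M N i + 1 \<and> jcol M N i \<le> n" if "2 \<le> i" "i \<le> n" for i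
    using fb_board[OF M lcol_mem[OF M that]] fb_board[OF N lcol_mem[OF N that]]
    by (auto simp: mem_board_iff jcol_def)
  have u: "1 \<le> jrow M N j \<and> jrow M N j \<le> j + 1" if "1 \<le> j" "j < n" for j
    using jrow_props(1,2)[OF that] highest_up_board[OF that] by (auto simp: mem_board_iff)
  have lu: "jrow M N (jcol M N i) < i" if i: "2 \<le> i" "i \<le> n" "jcol M N i < n" for i
  proof -
    have "1 \<le> jcol M N i" using l[of i] i by auto
    then have "jrow M N (jcol M N i) \<le> min (urow M (jcol M N i)) (urow N (jcol M N i))"
      using jrow_props(2) i by blast
    \<comment> \<open>One of \<open>M\<close> and \<open>N\<close> has its left-arrow of row
      \<open>i\<close> in this column, hence its up-arrow of the column above row
      \<open>i\<close>.\<close>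
    also have "\<dots> < i"
      using urow_less_if_lcol[OF M, of i] urow_less_if_lcol[OF N, of i] i
      by (auto simp: jcol_def min_def split: if_splits)
    finally show ?thesis .
  qed
  have ul: "j < jcol M N (jrow M N j)" if j: "1 \<le> j" "j < n" "2 \<le> jrow M N j" for j
  proof -
    have "jrow M N j \<le> n" using u[OF j(1,2)] j by auto
    \<comment> \<open>Equality would turn \<open>lu\<close> at row \<open>jrow M N j\<close> into
      \<open>jrow M N j < jrow M N j\<close>; this sharpens the weak bound of
      \<open>jrow_props(3)\<close>.\<close>
    then have "j \<noteq> jcol M N (jrow M N j)" using lu[of "jrow M N j"] j by auto
    then show ?thesis using jrow_props(3)[OF j] by auto
  qed
  have border: "(j + 1, j) \<in> D" if j: "1 \<le> j" "j < n" "jrow M N j \<le> j" "j < jcol M N (j + 1)" for j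
  proof -
    \<comment> \<open>The border cell is not pointed, so if neither up-arrow were above row
      \<open>j + 1\<close>, \<open>jrow\<close> would be at least \<open>j + 1\<close>. Thus
      \<open>M\<close> or \<open>N\<close> has its up-arrow above the border cell, which is then a
      free dot of that tableau.\<close>
    have "\<not> j + 1 \<le> min (urow M j) (urow N j)"
      using jrow_props(4)[OF j(1,2), of "j + 1"] j by auto
    moreover have "(j + 1, j) \<in> dots n T"
      if T: "fb_tableau n T" and "urow T j \<le> j" "jcol M N (j + 1) \<le> lcol T (j + 1)" for T
      using fb_border[OF T, of "j + 1"] that j by (auto simp: dots_iff[OF T] free_iff[OF T] mem_board_iff)
    from this[OF M] this[OF N] have "urow M j \<le> j \<or> urow N j \<le> j \<Longrightarrow> (j + 1, j) \<in> D"
      by (auto simp: jcol_def D_def)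
    ultimately show ?thesis by auto
  qed
  note L = tableau_of[of n "jcol M N" "jrow M N" D, OF n l u lu ul border]
  have "join_rules n M N (tableau_of n (jcol M N) (jrow M N) D)"
    using L by (subst join_rules_iff) (auto simp: D_def)
  then show ?thesis using L(1) by blast
qed

section \<open>The least upper bound property\<close>

lemma join_rules_upper:
  assumes L: "fb_tableau n L" and "join_rules n M N L"
  shows "tab_le n M L" "tab_le n N L"
  using assms(2) jrow_props(2)
  by (simp_all add: join_rules_iff[OF L] tab_le_iff[OF M L] tab_le_iff[OF N L] jcol_def
      dots_iff[OF M] dots_iff[OF N])

lemma join_rules_least:
  assumes L: "fb_tableau n L" and rules: "join_rules n M N L"
    and K: "fb_tableau n K" and MK: "tab_le n M K" and NK: "tab_le n N K"
  shows "tab_le n L K"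
  unfolding tab_le_iff[OF L K]
proof (intro conjI allI impI ballI)
  have Ll: "lcol L i = jcol M N i" if "2 \<le> i" "i \<le> n" for i
    using rules that by (simp add: join_rules_iff[OF L])
  have Kl: "lcol K i \<le> jcol M N i" if "2 \<le> i" "i \<le> n" for i
    using that MK NK by (simp add: tab_le_iff[OF M K] tab_le_iff[OF N K] jcol_def)
  show "lcol K i \<le> lcol L i" if "2 \<le> i \<and> i \<le> n" for i
    using Kl Ll that by simp
  show "urow K j \<le> urow L j" if j: "1 \<le> j \<and> j < n" for j
  proof -
    have b: "(urow K j, j) \<in> board n" using fb_board[OF K urow_mem[OF K]] j by auto
    have "urow K j \<le> jrow M N j"
    proof (rule jrow_props(4))
      show "urow K j \<le> min (urow M j) (urow N j)"
        using MK NK j by (simp add: tab_le_iff[OF M K] tab_le_iff[OF N K])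
      \<comment> \<open>The up-arrow of \<open>K\<close> is not pointed in \<open>K\<close>, and the
        left-arrows of \<open>K\<close> have labels at most \<open>jcol\<close>.\<close>
      show "j \<le> jcol M N (urow K j)" if "2 \<le> urow K j"
        using less_lcol_if_urow[OF K _ _ that] Kl[OF that] b j by (auto simp: mem_board_iff)
    qed (use j b in \<open>auto simp: mem_board_iff\<close>)
    then show ?thesis using rules j by (simp add: join_rules_iff[OF L])
  qed
  show "c \<in> K" if c: "c \<in> free_cells n L \<inter> free_cells n K" "c \<in> L" for c
  proof -
    have "c \<in> dots n M \<or> c \<in> dots n N" using rules c by (auto simp: join_rules_iff[OF L])
    \<comment> \<open>With the root excluded, a dot of \<open>M\<close> or \<open>N\<close> is free
      there, so the third condition of the order passes it on to \<open>K\<close>.\<close>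
    moreover have "c \<noteq> (1, n)" using c by (auto simp: free_iff[OF L])
    ultimately show ?thesis
      using c MK NK
      by (auto simp: dots_iff[OF M] dots_iff[OF N] tab_le_iff[OF M K] tab_le_iff[OF N K])
  qed
qed

end

lemma is_lub_esTam_unique:
  assumes "is_lub (esTam n) K A" "is_lub (esTam n) L A"
  shows "K = L"
proof (rule tab_le_antisym)
  show "fb_tableau n K" "fb_tableau n L" "tab_le n K L" "tab_le n L K"
    using assms by (auto simp: least_def Upper_def esTam_def)
qed

theorem lemma2p11:
  fixes n :: nat and M N :: filling
  assumes "n \<ge> 1" and "fb_tableau n M" and "fb_tableau n N"
  shows "(\<exists>!L. fb_tableau n L \<and> join_rules n M N L) \<and>
         (\<forall>L. fb_tableau n L \<and> join_rules n M N L \<longrightarrow>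
            is_lub (esTam n) L {M, N} \<and> L = M \<squnion>\<^bsub>esTam n\<^esub> N)"
proof -
  have lub: "is_lub (esTam n) L {M, N}" if "fb_tableau n L" "join_rules n M N L" for L
    using that assms(2,3) join_rules_upper[OF assms(2,3) that] join_rules_least[OF assms(2,3) that]
    by (auto simp: least_def Upper_def esTam_def)
  have "L = M \<squnion>\<^bsub>esTam n\<^esub> N" if "is_lub (esTam n) L {M, N}" for L
    \<comment> \<open>The library join is a choice among least upper bounds, so uniqueness
      identifies it with \<open>L\<close>.\<close>
    unfolding join_def sup_def
    using someI[of "\<lambda>x. is_lub (esTam n) x {M, N}", OF that] that is_lub_esTam_unique by blast
  \<comment> \<open>Two tableaux satisfying the rules are both least upper bounds of
    \<open>M\<close> and \<open>N\<close>, hence equal.\<close>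
  then show ?thesis
    using ex_join_rules[OF assms(2,3)] lub is_lub_esTam_unique by blast
qed

end
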